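(* For any integer $C\ge 1$ and any $\epsilon>0$, there is an instance of \textsc{L-Sided Pricing} in which every $u\in L$ has capacity $C$ and every $v\in R$ has capacity $1$, whose locality gap with respect to the single-swap heuristic (i.e. the $1$-swap heuristic) is at least $2-\epsilon$.
   Context: An instance of \textsc{L-Sided Pricing} consists of a finite bipartite graph $G=(L\cup R,E)$ (each edge joins $L$ and $R$), a capacity $\mu_w\in\mathbb Z_{\ge 0}\cup\{\infty\}$ for every vertex $w$, and a budget $b_e\ge 0$ for every edge $e$. For $u\in L$ let $P_u=\{b_e: e\in E\text{ incident to }u\}$. A pricing is a function $p$ on $L$ with $p(u)\in P_u$ for every $u\in L$, extended by $p(v)=0$ for $v\in R$. For a pricing $p$, $\mathrm{val}(p)$ is the maximum of $\sum_{e=uv\in F}(p(u)+p(v))$ over all $F\subseteq E$ such that $p(u)+p(v)\le b_e$ for every $e=uv\in F$ and every vertex $w$ is incident to at most $\mu_w$ edges of $F$. Let $p^*$ be a pricing maximizing $\mathrm{val}$. For $\rho\ge1$, the locality gap of the instance with respect to the $\rho$-swap heuristic is the maximum of $\mathrm{val}(p^* )/\mathrm{val}(p)$ over all pricings $p$ such that $\mathrm{val}(p')\le\mathrm{val}(p)$ for every pricing $p'$ differing from $p$ on at most $\rho$ vertices of $L$. *)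

theory Defs
  imports Complex_Main "HOL-Library.Extended_Nat"
begin

text \<open>An edge joining \<open>u \<in> L\<close> and \<open>v \<in> R\<close> is represented by the pair \<open>(u, v)\<close>.\<close>

record 'v lsp_instance =
  lside :: "'v set"
  rside :: "'v set"
  edges :: "('v \<times> 'v) set"
  cap :: "'v \<Rightarrow> enat"
  budget :: "'v \<times> 'v \<Rightarrow> real"

definition lsp_wf :: "'v lsp_instance \<Rightarrow> bool" where
  "lsp_wf I \<longleftrightarrow>
     finite (lside I) \<and> finite (rside I) \<and> lside I \<inter> rside I = {} \<and>
     edges I \<subseteq> lside I \<times> rside I \<and>
     (\<forall>e\<in>edges I. 0 \<le> budget I e)"

definition incident :: "'v \<Rightarrow> 'v \<times> 'v \<Rightarrow> bool" where
  "incident w e \<longleftrightarrow> w = fst e \<or> w = snd e"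

definition price_set :: "'v lsp_instance \<Rightarrow> 'v \<Rightarrow> real set" where
  "price_set I u = budget I ` {e \<in> edges I. incident u e}"

text \<open>The extension by \<open>0\<close> is imposed at every point outside \<open>L\<close>, including points that are
  not vertices, so that each pricing is represented by exactly one function.\<close>

definition pricings :: "'v lsp_instance \<Rightarrow> ('v \<Rightarrow> real) set" where
  "pricings I = {p. (\<forall>u\<in>lside I. p u \<in> price_set I u) \<and> (\<forall>w. w \<notin> lside I \<longrightarrow> p w = 0)}"

definition feasible_sales :: "'v lsp_instance \<Rightarrow> ('v \<Rightarrow> real) \<Rightarrow> ('v \<times> 'v) set set" where
  "feasible_sales I p =
     {F. F \<subseteq> edges I \<and>
         (\<forall>(u, v)\<in>F. p u + p v \<le> budget I (u, v)) \<and>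
         (\<forall>w\<in>lside I \<union> rside I. enat (card {e \<in> F. incident w e}) \<le> cap I w)}"

definition pricing_val :: "'v lsp_instance \<Rightarrow> ('v \<Rightarrow> real) \<Rightarrow> real" where
  "pricing_val I p = Max ((\<lambda>F. \<Sum>(u, v)\<in>F. p u + p v) ` feasible_sales I p)"

definition opt_val :: "'v lsp_instance \<Rightarrow> real" where
  "opt_val I = Max (pricing_val I ` pricings I)"

definition swap_local_optima :: "nat \<Rightarrow> 'v lsp_instance \<Rightarrow> ('v \<Rightarrow> real) set" where
  "swap_local_optima \<rho> I =
     {p \<in> pricings I. \<forall>p'\<in>pricings I.
        card {u \<in> lside I. p' u \<noteq> p u} \<le> \<rho> \<longrightarrow> pricing_val I p' \<le> pricing_val I p}"

text \<open>For \<open>\<rho> \<ge> 1\<close> a local optimum has value \<open>0\<close> only if the optimum is \<open>0\<close> (otherwise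
  some edge with positive budget has endpoints of positive capacity, and repricing its endpoint
  in \<open>L\<close> at that budget is an improving swap), so the only division by zero is \<open>0 / 0\<close>.\<close>

definition locality_gap :: "nat \<Rightarrow> 'v lsp_instance \<Rightarrow> real" where
  "locality_gap \<rho> I = Max ((\<lambda>p. opt_val I / pricing_val I p) ` swap_local_optima \<rho> I)"

end

theory Submission
  imports Defs
begin

text \<open>Two sellers \<open>a = 0\<close> and \<open>b = 1\<close> compete for \<open>C\<close> buyers of budget 1. Seller \<open>a\<close> also has
  \<open>C\<close> private buyers of budget \<open>1 - \<delta>\<close>, and \<open>b\<close> has one private buyer of budget 0. Pricing
  \<open>a\<close> at \<open>1 - \<delta>\<close> and \<open>b\<close> at 1 earns \<open>C (2 - \<delta>)\<close>. Pricing \<open>a\<close> at 1 and \<open>b\<close> at 0 earns only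
  \<open>C\<close>, yet no single swap helps: while \<open>b\<close> stays at 0, only the \<open>C\<close> sales of \<open>a\<close> count, and
  while \<open>a\<close> stays at 1 and \<open>b\<close> asks 1, all sales go to the \<open>C\<close> shared buyers.\<close>

lemma finite_edges: "lsp_wf I \<Longrightarrow> finite (edges I)"
  unfolding lsp_wf_def by (meson finite_SigmaI finite_subset)

text \<open>Prices on L are drawn from the finitely many budgets and every other point is pinned to
  0. This is what makes the maxima in \<open>opt_val\<close> and \<open>locality_gap\<close> bound
  their members.\<close>

lemma finite_pricings:
  assumes "lsp_wf I"
  shows "finite (pricings I)"
proof (rule finite_subset)
  show "pricings I \<subseteq> {p. \<forall>w. (w \<in> lside I \<longrightarrow> p w \<in> budget I ` edges I) \<and> (w \<notin> lside I \<longrightarrow> p w = 0)}"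
    by (auto simp: pricings_def price_set_def)
  show "finite {p. \<forall>w. (w \<in> lside I \<longrightarrow> p w \<in> budget I ` edges I) \<and> (w \<notin> lside I \<longrightarrow> p w = 0)}"
    using assms finite_edges[OF assms]
    by (intro finite_set_of_finite_funs) (auto simp: lsp_wf_def)
qed

lemma finite_feasible_sales: "lsp_wf I \<Longrightarrow> finite (feasible_sales I p)"
  by (rule finite_subset[of _ "Pow (edges I)"]) (auto simp: feasible_sales_def finite_edges)

text \<open>Keeps the set under \<open>Max\<close> in \<open>pricing_val\<close> nonempty.\<close>

lemma empty_feasible_sales: "{} \<in> feasible_sales I p"
  by (simp add: feasible_sales_def flip: zero_enat_def)

lemma pricing_val_ge:
  assumes "lsp_wf I" "F \<in> feasible_sales I p"
  shows "(\<Sum>(u, v)\<in>F. p u + p v) \<le> pricing_val I p"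
  unfolding pricing_val_def
  by (rule Max_ge) (use assms finite_feasible_sales in auto)

lemma pricing_val_le:
  assumes "lsp_wf I" "\<And>F. F \<in> feasible_sales I p \<Longrightarrow> (\<Sum>(u, v)\<in>F. p u + p v) \<le> x"
  shows "pricing_val I p \<le> x"
  unfolding pricing_val_def
  by (rule Max.boundedI) (use assms finite_feasible_sales empty_feasible_sales[of I p] in auto)

lemma pricing_val_le_opt_val: "lsp_wf I \<Longrightarrow> p \<in> pricings I \<Longrightarrow> pricing_val I p \<le> opt_val I"
  unfolding opt_val_def by (rule Max_ge) (auto simp: finite_pricings)

lemma locality_gap_ge:
  assumes "lsp_wf I" "p \<in> swap_local_optima \<rho> I"
  shows "opt_val I / pricing_val I p \<le> locality_gap \<rho> I"
  unfolding locality_gap_def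
proof (rule Max_ge)
  have "finite (swap_local_optima \<rho> I)"
    by (rule finite_subset[OF _ finite_pricings[OF assms(1)]]) (auto simp: swap_local_optima_def)
  then show "finite ((\<lambda>p. opt_val I / pricing_val I p) ` swap_local_optima \<rho> I)" by simp
qed (use assms in auto)

text \<open>The vertex 2 is the private buyer of \<open>b\<close>, the interval \<open>{3..<3 + C}\<close> holds the shared buyers,
  and \<open>{3 + C..<3 + 2 * C}\<close> the private buyers of \<open>a\<close>.\<close>

definition gap_instance :: "nat \<Rightarrow> real \<Rightarrow> nat lsp_instance" where
  "gap_instance C \<delta> =
     \<lparr>lside = {0, 1},
      rside = {2..<3 + 2 * C},
      edges = {0} \<times> {3..<3 + 2 * C} \<union> {1} \<times> {2..<3 + C},
      cap = (\<lambda>w. if w < 2 then enat C else 1),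
      budget = (\<lambda>(u, v). if v = 2 then 0 else if v < 3 + C then 1 else 1 - \<delta>)\<rparr>"

lemma gap_instance_wf: "\<delta> \<le> 1 \<Longrightarrow> lsp_wf (gap_instance C \<delta>)"
  by (auto simp: lsp_wf_def gap_instance_def)

lemma gap_instance_price_set:
  assumes "C \<ge> 1"
  shows "price_set (gap_instance C \<delta>) 0 = {1, 1 - \<delta>}"
    and "price_set (gap_instance C \<delta>) 1 = {0, 1}"
proof -
  show "price_set (gap_instance C \<delta>) 0 = {1, 1 - \<delta>}"
  proof
    \<comment> \<open>One shared and one private buyer witness the two prices; both exist because
      \<open>C \<ge> 1\<close>.\<close>
    have "(0, 3) \<in> {e \<in> edges (gap_instance C \<delta>). incident 0 e}"
         "(0, 3 + C) \<in> {e \<in> edges (gap_instance C \<delta>). incident 0 e}"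
      using assms by (auto simp: gap_instance_def incident_def)
    from this[THEN imageI, of "budget (gap_instance C \<delta>)"]
    show "{1, 1 - \<delta>} \<subseteq> price_set (gap_instance C \<delta>) 0"
      using assms by (simp add: price_set_def) (simp add: gap_instance_def)
  qed (auto simp: price_set_def gap_instance_def incident_def)
  show "price_set (gap_instance C \<delta>) 1 = {0, 1}"
  proof
    have "(1, 2) \<in> {e \<in> edges (gap_instance C \<delta>). incident 1 e}"
         "(1, 3) \<in> {e \<in> edges (gap_instance C \<delta>). incident 1 e}"
      using assms by (auto simp: gap_instance_def incident_def)
    from this[THEN imageI, of "budget (gap_instance C \<delta>)"]
    show "{0, 1} \<subseteq> price_set (gap_instance C \<delta>) 1"
      using assms by (simp add: price_set_def) (simp add: gap_instance_def)
  qed (auto simp: price_set_def gap_instance_def incident_def)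
qed

lemma gap_instance_pricings:
  assumes "C \<ge> 1"
  shows "p \<in> pricings (gap_instance C \<delta>) \<longleftrightarrow>
    p 0 \<in> {1, 1 - \<delta>} \<and> p 1 \<in> {0, 1} \<and> (\<forall>w. 2 \<le> w \<longrightarrow> p w = 0)"
proof -
  have "lside (gap_instance C \<delta>) = {0, 1}" by (simp add: gap_instance_def)
  moreover have "w \<notin> {0, 1} \<longleftrightarrow> 2 \<le> w" for w :: nat by auto
  ultimately show ?thesis
    unfolding pricings_def
    by (simp only: gap_instance_price_set[OF assms] mem_Collect_eq ball_simps simp_thms conj_assoc)
qed

text \<open>The assumption \<open>swap\<close> describes the pricings within one swap of the local
  optimum \<open>p 0 = 1\<close>, \<open>p 1 = 0\<close>. The capacity of seller 0 gives the bound
  if \<open>p 1 = 0\<close>, and the number of shared buyers gives it if both sellers ask 1.\<close>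

lemma gap_instance_val_le:
  assumes "C \<ge> 1" "0 < \<delta>" "\<delta> \<le> 1"
    and p: "p \<in> pricings (gap_instance C \<delta>)"
    and swap: "p 0 = 1 \<or> p 1 = 0"
  shows "pricing_val (gap_instance C \<delta>) p \<le> C"
proof (rule pricing_val_le[OF gap_instance_wf[OF assms(3)]])
  fix F assume F: "F \<in> feasible_sales (gap_instance C \<delta>) p"
  have pw: "p 0 \<le> 1" "p 1 \<in> {0, 1}" "\<And>w. 2 \<le> w \<Longrightarrow> p w = 0"
    using p assms(2) unfolding gap_instance_pricings[OF assms(1)] by auto
  have FE: "F \<subseteq> {0} \<times> {3..<3 + 2 * C} \<union> {1} \<times> {2..<3 + C}"
    using F by (auto simp: feasible_sales_def gap_instance_def)
  then have fin: "finite F" by (rule finite_subset) auto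
  show "(\<Sum>(u, v)\<in>F. p u + p v) \<le> C"
  proof (cases "p 1 = 0")
    case True
    have "(\<Sum>(u, v)\<in>F. p u + p v) \<le> (\<Sum>e\<in>F. if incident 0 e then 1 else 0)"
      using FE pw True by (intro sum_mono) (auto simp: incident_def)
    also have "\<dots> = card {e \<in> F. incident 0 e}"
      using fin by (simp add: sum.If_cases Int_def)
    also have "\<dots> \<le> C"
      using F by (auto simp: feasible_sales_def gap_instance_def)
    finally show ?thesis by simp
  next
    case False
    then have ones: "p 0 = 1" "p 1 = 1" using swap pw by auto
    \<comment> \<open>A price of 1 exceeds both the budget 0 and, since \<open>0 < \<delta>\<close>,
      the budget \<open>1 - \<delta>\<close>.\<close>
    have shared: "snd ` F \<subseteq> {3..<3 + C}"
    proof
      fix v assume "v \<in> snd ` F"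
      then obtain u where uv: "(u, v) \<in> F" by auto
      then have "p u + p v \<le> budget (gap_instance C \<delta>) (u, v)"
        using F by (auto simp: feasible_sales_def)
      moreover have "p u = 1" "p v = 0" "2 \<le> v" using uv FE ones pw(3) by auto
      ultimately show "v \<in> {3..<3 + C}"
        using assms(2) by (auto simp: gap_instance_def split: if_splits)
    qed
    \<comment> \<open>Buyers have capacity 1, so two sales to the same buyer coincide.\<close>
    have inj: "inj_on snd F"
    proof (rule inj_onI)
      fix e f assume ef: "e \<in> F" "f \<in> F" "snd e = snd f"
      have "snd e \<in> {2..<3 + 2 * C}" using FE ef(1) by auto
      then have "card {g \<in> F. incident (snd e) g} \<le> 1"
        using F by (auto simp: feasible_sales_def gap_instance_def one_enat_def)
      moreover have "{e, f} \<subseteq> {g \<in> F. incident (snd e) g}"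
        using ef by (auto simp: incident_def)
      ultimately have "card {e, f} \<le> 1"
        using fin card_mono[of "{g \<in> F. incident (snd e) g}" "{e, f}"] by simp
      then show "e = f" by (cases "e = f") auto
    qed
    have "(\<Sum>(u, v)\<in>F. p u + p v) \<le> (\<Sum>e\<in>F. 1)"
      using FE pw by (intro sum_mono) auto
    also have "\<dots> = card (snd ` F)" by (simp add: card_image[OF inj])
    also have "\<dots> \<le> C" using card_mono[OF _ shared] by simp
    finally show ?thesis by simp
  qed
qed

text \<open>Seller 0 can serve all \<open>C\<close> shared buyers at price 1, whatever seller 1
  asks.\<close>

lemma gap_instance_val_ge:
  assumes "C \<ge> 1" "\<delta> \<le> 1" and p: "p \<in> pricings (gap_instance C \<delta>)" and "p 0 = 1"
  shows "C \<le> pricing_val (gap_instance C \<delta>) p"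
proof -
  let ?F = "{0::nat} \<times> {3..<3 + C}"
  have p0: "\<And>w. 2 \<le> w \<Longrightarrow> p w = 0"
    using p unfolding gap_instance_pricings[OF assms(1)] by auto
  have "?F \<in> feasible_sales (gap_instance C \<delta>) p"
    unfolding feasible_sales_def
  proof (intro CollectI conjI ballI)
    fix w assume "w \<in> lside (gap_instance C \<delta>) \<union> rside (gap_instance C \<delta>)"
    have "{e \<in> ?F. incident w e} \<subseteq> (if w < 2 then ?F else {(0, w)})"
      by (auto simp: incident_def)
    then have "card {e \<in> ?F. incident w e} \<le> card (if w < 2 then ?F else {(0, w)})"
      by (intro card_mono) auto
    then show "enat (card {e \<in> ?F. incident w e}) \<le> cap (gap_instance C \<delta>) w"
      by (auto simp: gap_instance_def one_enat_def split: if_splits)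
  qed (use assms p0 in \<open>auto simp: gap_instance_def\<close>)
  from pricing_val_ge[OF gap_instance_wf[OF assms(2)] this]
  show ?thesis using assms(4) p0 by (simp add: sum.cartesian_product[symmetric])
qed

lemma gap_instance_opt_ge:
  assumes "C \<ge> 1" "\<delta> \<le> 1"
  shows "C * (2 - \<delta>) \<le> opt_val (gap_instance C \<delta>)"
proof -
  define p :: "nat \<Rightarrow> real" where "p = (\<lambda>w. if w = 0 then 1 - \<delta> else if w = 1 then 1 else 0)"
  let ?A = "{0::nat} \<times> {3 + C..<3 + 2 * C}" and ?B = "{1::nat} \<times> {3..<3 + C}"
  have "?A \<union> ?B \<in> feasible_sales (gap_instance C \<delta>) p"
    unfolding feasible_sales_def
  proof (intro CollectI conjI ballI)
    fix w assume "w \<in> lside (gap_instance C \<delta>) \<union> rside (gap_instance C \<delta>)"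
    \<comment> \<open>The two sellers serve disjoint groups of buyers, so each buyer meets at most
      one sale. For \<open>w = 2\<close> there is none, and \<open>?X\<close> is merely a
      superset.\<close>
    let ?X = "if w = 0 then ?A else if w = 1 then ?B else {(if w < 3 + C then 1 else 0, w)}"
    have "{e \<in> ?A \<union> ?B. incident w e} \<subseteq> ?X"
      by (auto simp: incident_def)
    then have "card {e \<in> ?A \<union> ?B. incident w e} \<le> card ?X"
      by (intro card_mono) auto
    then show "enat (card {e \<in> ?A \<union> ?B. incident w e}) \<le> cap (gap_instance C \<delta>) w"
      by (auto simp: gap_instance_def one_enat_def split: if_splits)
  qed (use assms in \<open>auto simp: gap_instance_def p_def\<close>)
  from pricing_val_ge[OF gap_instance_wf[OF assms(2)] this]
  have "(\<Sum>(u, v)\<in>?A \<union> ?B. p u + p v) \<le> pricing_val (gap_instance C \<delta>) p" .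
  moreover have "(\<Sum>(u, v)\<in>?A \<union> ?B. p u + p v) = (\<Sum>(u, v)\<in>?A. p u + p v) + (\<Sum>(u, v)\<in>?B. p u + p v)"
    by (rule sum.union_disjoint) auto
  moreover have "(\<Sum>(u, v)\<in>?A. p u + p v) = C * (1 - \<delta>)" "(\<Sum>(u, v)\<in>?B. p u + p v) = C"
    by (simp_all add: sum.cartesian_product[symmetric] p_def)
  moreover have "p \<in> pricings (gap_instance C \<delta>)"
    unfolding gap_instance_pricings[OF assms(1)] by (auto simp: p_def)
  ultimately show ?thesis
    using pricing_val_le_opt_val[OF gap_instance_wf[OF assms(2)], of p C]
    by (simp add: algebra_simps)
qed

lemma gap_instance_locality_gap:
  assumes "C \<ge> 1" "0 < \<delta>" "\<delta> \<le> 1"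
  shows "2 - \<delta> \<le> locality_gap 1 (gap_instance C \<delta>)"
proof -
  let ?I = "gap_instance C \<delta>"
  define p :: "nat \<Rightarrow> real" where "p = (\<lambda>w. if w = 0 then 1 else 0)"
  have p: "p \<in> pricings ?I"
    unfolding gap_instance_pricings[OF assms(1)] by (auto simp: p_def)
  have ge: "C \<le> pricing_val ?I p"
    using gap_instance_val_ge[OF assms(1,3) p] by (simp add: p_def)
  have le: "pricing_val ?I q \<le> C"
    if q: "q \<in> pricings ?I" "card {u \<in> lside ?I. q u \<noteq> p u} \<le> 1" for q
  \<comment> \<open>A pricing violating \<open>swap\<close> would differ from \<open>p\<close> at
    both sellers.\<close>
  proof (rule gap_instance_val_le[OF assms q(1)], rule ccontr)
    assume "\<not> (q 0 = 1 \<or> q 1 = 0)"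
    then have "{u \<in> lside ?I. q u \<noteq> p u} = {0, 1}"
      by (auto simp: gap_instance_def p_def)
    with q(2) show False by simp
  qed
  have "p \<in> swap_local_optima 1 ?I"
    unfolding swap_local_optima_def using p order_trans[OF le ge] by blast
  from locality_gap_ge[OF gap_instance_wf[OF assms(3)] this]
  have "opt_val ?I / pricing_val ?I p \<le> locality_gap 1 ?I" .
  moreover have "pricing_val ?I p = C" using ge le[OF p] by simp
  moreover have "2 - \<delta> \<le> opt_val ?I / C"
    using gap_instance_opt_ge[OF assms(1,3)] assms(1)
    by (simp add: pos_le_divide_eq mult.commute)
  ultimately show ?thesis by simp
qed

theorem theorem11:
  fixes C :: nat and \<epsilon> :: real
  assumes "C \<ge> 1" and "\<epsilon> > 0"
  shows "\<exists>I :: nat lsp_instance.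
           lsp_wf I \<and>
           (\<forall>u\<in>lside I. cap I u = enat C) \<and>
           (\<forall>v\<in>rside I. cap I v = 1) \<and>
           locality_gap 1 I \<ge> 2 - \<epsilon>"
proof -
  \<comment> \<open>Capping at 1 keeps the budget \<open>1 - \<delta>\<close> nonnegative and only
    strengthens the bound.\<close>
  let ?I = "gap_instance C (min \<epsilon> 1)"
  have "2 - min \<epsilon> 1 \<le> locality_gap 1 ?I"
    using assms by (intro gap_instance_locality_gap) auto
  then have "locality_gap 1 ?I \<ge> 2 - \<epsilon>" by linarith
  moreover have "lsp_wf ?I" by (simp add: gap_instance_wf)
  moreover have "\<forall>u\<in>lside ?I. cap ?I u = enat C" "\<forall>v\<in>rside ?I. cap ?I v = 1"
    by (simp_all add: gap_instance_def)
  ultimately show ?thesis by (intro exI[of _ ?I] conjI)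
qed

end
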